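(* Let $D$ be an offline RL training dataset, and let $\mathcal{M}$ be a randomized learning algorithm that satisfies a $(\mathcal{K},r)$-outcomes guarantee and outputs a policy $\pi=\mathcal{M}(D)$ over a finite action space $\mathcal{A}=\{A_1,\dots,A_L\}$. Let $I$ be the inferred score function, and let $s_t$ be an arbitrary test-time input state with corresponding output action $a_t=\arg\max_{a_l\in\mathcal{A}}I_{a_l}(s_t,\pi)$. If there exist $K_1,K_2\in\mathcal{K}$ such that $$K_1^{-1}\big(I_{a_t}(s_t,\pi)\big)\;>\;\max_{a_l\in\mathcal{A}\setminus\{a_t\}}K_2\big(I_{a_l}(s_t,\pi)\big),$$ then the algorithm preserves action-level robustness at state $s_t$ under a poisoning attack of size $r$; that is, for any poisoned dataset $\tilde D\in\mathcal{B}(D,r)$, the clean policy $\pi=\mathcal{M}(D)$ and the poisoned policy $\tilde\pi=\mathcal{M}(\tilde D)$ produce the same action, $\pi(s_t)=\tilde\pi(s_t)$, with probability at least $1-\delta'$.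
   Context: Datasets: a dataset $D$ is a finite collection of records. The records are either transitions (state, action, next state, reward) or trajectories (sequences of transitions over an episode). $\mathcal{B}(D,r)$ is the set of all datasets $\tilde D$ such that the minimum number of record changes (additions, deletions or alterations) needed to map $D$ to $\tilde D$ is at most $r$. Outcomes guarantee: a randomized function $\mathcal{M}$ on datasets preserves (satisfies) a $(\mathcal{K},r)$-outcomes guarantee, for a family $\mathcal{K}$ of functions, if for every $K\in\mathcal{K}$, all datasets $D_1$ and $D_2\in\mathcal{B}(D_1,r)$, and all measurable $S\subseteq\mathrm{Range}(\mathcal{M})$, $\Pr[\mathcal{M}(D_1)\in S]\le K(\Pr[\mathcal{M}(D_2)\in S])$. The family $\mathcal{K}$ is either an ADP (approximate differential privacy) family, where each $K\in\mathcal{K}$ has the form $K(x)=e^{\epsilon}x+\delta$ with $\epsilon>0$, $\delta\in[0,1)$, or an RDP (Rényi differential privacy) family, where each $K\in\mathcal{K}$ has the form $K(x)=(e^{\epsilon}x)^{(\alpha-1)/\alpha}$ with $\epsilon>0$, $\alpha>1$. Each such $K$ is strictly increasing, and $K^{-1}$ denotes its inverse: $K^{-1}(y)=e^{-\epsilon}(y-\delta)$ in the ADP case, $K^{-1}(y)=e^{-\epsilon}y^{\alpha/(\alpha-1)}$ in the RDP case. Inferred scores: a randomized policy $\pi=\mathcal{M}(D)$ is a random element (randomness from training); each realization $\hat\pi$ has an action-value function $Q_{\hat\pi}:\mathcal{S}\times\mathcal{A}\to\mathbb{R}$, where $\mathcal S$ is the state space, and picks at a state $s_t$ the action maximizing $Q_{\hat\pi}(s_t,\cdot)$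 (ties broken by a fixed rule). The inferred score of action $A_l$ is $$I_{A_l}(s_t,\pi)=\Pr\big[\arg\max_{a_i}Q_{\pi}(s_t,a_i)=A_l\big],$$ the probability being over the training randomness of $\pi$; thus $I_{A_l}(s_t,\pi)\in[0,1]$ and $\sum_{A_l\in\mathcal{A}}I_{A_l}(s_t,\pi)=1$. The action $\pi(s_t)$ chosen by the randomized policy $\pi$ at $s_t$ is the action with the highest inferred score $I_{A_l}(s_t,\pi)$, and likewise $\tilde\pi(s_t)$ is the action with the highest inferred score $I_{A_l}(s_t,\tilde\pi)$. Action-level robustness: given a clean dataset $D$, a state $s_t$ and a poisoning size $r$, action-level robustness at $s_t$ under a poisoning attack of size $r$ means that for any poisoned dataset $\tilde D\in\mathcal{B}(D,r)$, the clean and poisoned policies $\pi=\mathcal{M}(D)$ and $\tilde\pi=\mathcal{M}(\tilde D)$ produce the same action, $\pi(s_t)=\tilde\pi(s_t)$, with probability at least $1-\delta'$. Here $\delta'\in(0,1)$ is the confidence parameter fixed in this definition; it is unrelated to the ADP parameter $\delta$. *)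

theory Defs
  imports "HOL-Probability.Probability" "HOL-Library.Multiset"
begin

type_synonym ('s, 'a) transition = "'s \<times> 'a \<times> 's \<times> real"

datatype ('s, 'a) data_record =
    Transition "('s, 'a) transition"
  | Trajectory "('s, 'a) transition list"

text \<open>The records of one dataset all have the same kind: the learner works either at transition
  level or at trajectory level.\<close>

datatype granularity = Transition_Level | Trajectory_Level

fun records :: "granularity \<Rightarrow> ('s, 'a) data_record set" where
  "records Transition_Level = range Transition"
| "records Trajectory_Level = range Trajectory"

definition datasets :: "granularity \<Rightarrow> ('s, 'a) data_record multiset set" where
  "datasets g = {D. set_mset D \<subseteq> records g}"

text \<open>One record change: an addition, a deletion or an alteration.\<close>

definition record_change ::
    "granularity \<Rightarrow> (('s, 'a) data_record multiset \<times> ('s, 'a) data_record multiset) set" where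
  "record_change g = {(D, D'). D \<in> datasets g \<and> D' \<in> datasets g \<and>
     ((\<exists>x. D' = add_mset x D) \<or>
      (\<exists>x. D = add_mset x D') \<or>
      (\<exists>E x y. D = add_mset x E \<and> D' = add_mset y E))}"

text \<open>For two elements of \<open>datasets g\<close> the minimum is attained: delete all records of the first,
  then add those of the second.\<close>

definition record_distance ::
    "granularity \<Rightarrow> ('s, 'a) data_record multiset \<Rightarrow> ('s, 'a) data_record multiset \<Rightarrow> nat" where
  "record_distance g D D' = (LEAST n. (D, D') \<in> record_change g ^^ n)"

definition poison_ball ::
    "granularity \<Rightarrow> ('s, 'a) data_record multiset \<Rightarrow> nat \<Rightarrow> ('s, 'a) data_record multiset set" where
  "poison_ball g D r = {D' \<in> datasets g. record_distance g D D' \<le> r}"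

text \<open>The functions \<open>K\<close> are represented by their parameters, so that the inverse can be given by
  its closed form on all arguments that occur.  In particular \<open>K_inv (ADP \<epsilon> \<delta>) y\<close> is negative
  for \<open>y < \<delta>\<close>.  The function \<open>K_fun (RDP \<epsilon> \<alpha>)\<close> and its inverse are meant for nonnegative
  arguments.\<close>

datatype bound_fun = ADP real real | RDP real real

fun K_fun :: "bound_fun \<Rightarrow> real \<Rightarrow> real" where
  "K_fun (ADP \<epsilon> \<delta>) x = exp \<epsilon> * x + \<delta>"
| "K_fun (RDP \<epsilon> \<alpha>) x = (exp \<epsilon> * x) powr ((\<alpha> - 1) / \<alpha>)"

fun K_inv :: "bound_fun \<Rightarrow> real \<Rightarrow> real" where
  "K_inv (ADP \<epsilon> \<delta>) y = exp (- \<epsilon>) * (y - \<delta>)"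
| "K_inv (RDP \<epsilon> \<alpha>) y = exp (- \<epsilon>) * y powr (\<alpha> / (\<alpha> - 1))"

definition ADP_family :: "bound_fun set \<Rightarrow> bool" where
  "ADP_family \<K> \<longleftrightarrow> (\<forall>K\<in>\<K>. \<exists>\<epsilon> \<delta>. K = ADP \<epsilon> \<delta> \<and> 0 < \<epsilon> \<and> 0 \<le> \<delta> \<and> \<delta> < 1)"

definition RDP_family :: "bound_fun set \<Rightarrow> bool" where
  "RDP_family \<K> \<longleftrightarrow> (\<forall>K\<in>\<K>. \<exists>\<epsilon> \<alpha>. K = RDP \<epsilon> \<alpha> \<and> 0 < \<epsilon> \<and> 1 < \<alpha>)"

lemma K_inv_K_fun:
  assumes "ADP_family {K} \<or> RDP_family {K}" "0 \<le> x"
  shows "K_inv K (K_fun K x) = x" "K_fun K (K_inv K x) = x"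
  using assms
  by (auto simp: ADP_family_def RDP_family_def powr_powr powr_mult field_simps exp_minus)

text \<open>A randomized function on datasets sends each dataset to a random element of the measurable
  space \<open>P\<close> of policies; all training randomness lives on the probability space \<open>\<Omega>\<close>.\<close>

definition randomized_algorithm ::
    "granularity \<Rightarrow> 'w measure \<Rightarrow> 'p measure \<Rightarrow> (('s, 'a) data_record multiset \<Rightarrow> 'w \<Rightarrow> 'p) \<Rightarrow> bool" where
  "randomized_algorithm g \<Omega> P M \<longleftrightarrow> prob_space \<Omega> \<and> (\<forall>D\<in>datasets g. M D \<in> measurable \<Omega> P)"

definition outcomes_guarantee ::
    "granularity \<Rightarrow> 'w measure \<Rightarrow> 'p measure \<Rightarrow> (('s, 'a) data_record multiset \<Rightarrow> 'w \<Rightarrow> 'p) \<Rightarrow>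
     bound_fun set \<Rightarrow> nat \<Rightarrow> bool" where
  "outcomes_guarantee g \<Omega> P M \<K> r \<longleftrightarrow>
     (\<forall>K\<in>\<K>. \<forall>D\<^sub>1\<in>datasets g. \<forall>D\<^sub>2\<in>poison_ball g D\<^sub>1 r. \<forall>S\<in>sets P.
        \<P>(\<omega> in \<Omega>. M D\<^sub>1 \<omega> \<in> S) \<le> K_fun K \<P>(\<omega> in \<Omega>. M D\<^sub>2 \<omega> \<in> S))"

text \<open>A fixed tie-breaking rule selects one element of each nonempty set of maximizers.\<close>

definition tie_rule :: "('a set \<Rightarrow> 'a) \<Rightarrow> bool" where
  "tie_rule tie \<longleftrightarrow> (\<forall>T. T \<noteq> {} \<longrightarrow> tie T \<in> T)"

definition argmax :: "('a set \<Rightarrow> 'a) \<Rightarrow> ('a \<Rightarrow> real) \<Rightarrow> 'a" where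
  "argmax tie f = tie {a. is_arg_max f (\<lambda>_. True) a}"

definition inferred_score ::
    "'w measure \<Rightarrow> ('p \<Rightarrow> 's \<Rightarrow> 'a \<Rightarrow> real) \<Rightarrow> ('a set \<Rightarrow> 'a) \<Rightarrow> ('w \<Rightarrow> 'p) \<Rightarrow> 's \<Rightarrow> 'a \<Rightarrow> real" where
  "inferred_score \<Omega> Q tie \<pi> s a = \<P>(\<omega> in \<Omega>. argmax tie (Q (\<pi> \<omega>) s) = a)"

definition policy_action ::
    "'w measure \<Rightarrow> ('p \<Rightarrow> 's \<Rightarrow> 'a \<Rightarrow> real) \<Rightarrow> ('a set \<Rightarrow> 'a) \<Rightarrow> ('w \<Rightarrow> 'p) \<Rightarrow> 's \<Rightarrow> 'a" where
  "policy_action \<Omega> Q tie \<pi> s = argmax tie (inferred_score \<Omega> Q tie \<pi> s)"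

text \<open>The action of a randomized policy is determined by its inferred scores, so the event below
  does not vary with the training randomness \<open>\<omega>\<close>.\<close>

definition action_level_robust ::
    "granularity \<Rightarrow> 'w measure \<Rightarrow> ('p \<Rightarrow> 's \<Rightarrow> 'a \<Rightarrow> real) \<Rightarrow> ('a set \<Rightarrow> 'a) \<Rightarrow>
     (('s, 'a) data_record multiset \<Rightarrow> 'w \<Rightarrow> 'p) \<Rightarrow> ('s, 'a) data_record multiset \<Rightarrow> 's \<Rightarrow> nat \<Rightarrow>
     real \<Rightarrow> bool" where
  "action_level_robust g \<Omega> Q tie M D s r \<delta>' \<longleftrightarrow>
     (\<forall>D'\<in>poison_ball g D r.
        1 - \<delta>' \<le> \<P>(\<omega> in \<Omega>. policy_action \<Omega> Q tie (M D) s = policy_action \<Omega> Q tie (M D') s))"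

end

(* The event that the policy picks the action a at s_t is the preimage of a measurable set of
   policies, so the outcomes guarantee bounds inferred scores. Since record changes are
   reversible, it applies in both directions: from D to D' with K1 it bounds the poisoned score
   of a_t from below by K1^{-1}(I(a_t)), and from D' to D with K2 it bounds every other poisoned
   score from above by K2(I(a)). *)
theory Submission
  imports Defs
begin

lemma sym_record_change: "sym (record_change g)"
  by (rule symI) (auto simp: record_change_def)

lemma sym_relpow:
  assumes "sym R"
  shows "sym (R ^^ n)"
proof (induction n)
  case (Suc n)
  have "(R ^^ Suc n)\<inverse> = R\<inverse> O (R ^^ n)\<inverse>"
    by (simp add: converse_relcomp)
  \<comment> \<open>Reversal has moved the extra factor \<open>R\<close> to the front;
    \<open>relpow_commute\<close> brings it back to the end.\<close>
  also have "\<dots> = R ^^ Suc n"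
    using assms Suc by (simp only: sym_conv_converse_eq relpow_commute relpow.simps)
  finally show ?case
    by (simp only: sym_conv_converse_eq)
qed (simp add: sym_Id)

lemma record_distance_commute: "record_distance g D D' = record_distance g D' D"
proof -
  have "(D, D') \<in> record_change g ^^ n \<longleftrightarrow> (D', D) \<in> record_change g ^^ n" for n
    using sym_relpow[OF sym_record_change, of n g] by (auto dest: symD)
  then show ?thesis by (simp add: record_distance_def)
qed

lemma poison_ball_sym:
  assumes "D \<in> datasets g" "D' \<in> poison_ball g D r"
  shows "D \<in> poison_ball g D' r"
  using assms by (simp add: poison_ball_def record_distance_commute)

text \<open>\<open>K_inv K\<close> is monotone on nonnegative arguments: affine with positive slope
  for ADP, a power with positive exponent for RDP. Applying it to the bound cancels
  \<open>K_fun K\<close>, since \<open>y\<close> is nonnegative. This turns the guarantee into a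
  lower bound for the poisoned score.\<close>

lemma K_inv_le_of_le_K_fun:
  assumes "ADP_family \<K> \<or> RDP_family \<K>" "K \<in> \<K>" "0 \<le> x" "0 \<le> y" "x \<le> K_fun K y"
  shows "K_inv K x \<le> y"
proof -
  have K: "ADP_family {K} \<or> RDP_family {K}"
    using assms(1,2) by (auto simp: ADP_family_def RDP_family_def)
  then have "K_inv K x \<le> K_inv K (K_fun K y)"
    using assms(3,5) by (auto simp: ADP_family_def RDP_family_def intro!: powr_mono2)
  then show ?thesis
    using K_inv_K_fun(1)[OF K \<open>0 \<le> y\<close>] by simp
qed

text \<open>The tie rule is an arbitrary function of the set of maximizers, so the event is split
  according to that set \<open>T\<close>. A finite action type has only finitely many such
  \<open>T\<close>.\<close>

lemma argmax_vimage_sets: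
  fixes f :: "'p \<Rightarrow> 'a::finite \<Rightarrow> real"
  assumes [measurable]: "\<And>a. (\<lambda>p. f p a) \<in> borel_measurable P"
  shows "{p \<in> space P. argmax tie (f p) = a} \<in> sets P"
proof -
  have "{p \<in> space P. argmax tie (f p) = a} =
      (\<Union>T\<in>{T. tie T = a}. {p \<in> space P. {b. is_arg_max (f p) (\<lambda>_. True) b} = T})"
    by (auto simp: argmax_def)
  \<comment> \<open>For fixed \<open>T\<close>, only finitely many comparisons of measurable
    functions remain.\<close>
  also have "\<dots> = (\<Union>T\<in>{T. tie T = a}. {p \<in> space P. \<forall>b. b \<in> T \<longleftrightarrow> (\<forall>c. f p c \<le> f p b)})"
    by (simp add: set_eq_iff is_arg_max_linorder eq_commute)
  finally have "{p \<in> space P. argmax tie (f p) = a} = \<dots>" .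
  moreover have "{p \<in> space P. \<forall>b. b \<in> T \<longleftrightarrow> (\<forall>c. f p c \<le> f p b)} \<in> sets P" for T
    by measurable
  ultimately show ?thesis by (simp add: sets.finite_UN)
qed

text \<open>A strict maximizer is the only one, which leaves the tie rule no choice.\<close>

lemma argmax_eqI:
  assumes "tie_rule tie" "\<And>b. b \<noteq> a \<Longrightarrow> f b < f a"
  shows "argmax tie f = a"
proof -
  have "{b. is_arg_max f (\<lambda>_. True) b} = {a}"
    using assms(2) by (auto simp: is_arg_max_def) (metis less_asym)+
  then show ?thesis
    using assms(1) by (auto simp: argmax_def tie_rule_def)
qed

(* The maximum over the other actions is a supremum in the extended reals, so that it is
   minus infinity when there is only one action. *)
theorem theorem4p4:
  fixes g :: granularity
    and \<Omega> :: "'w measure"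
    and P :: "'p measure"
    and M :: "('s, 'a::finite) data_record multiset \<Rightarrow> 'w \<Rightarrow> 'p"
    and Q :: "'p \<Rightarrow> 's \<Rightarrow> 'a \<Rightarrow> real"
    and tie :: "'a set \<Rightarrow> 'a"
    and \<K> :: "bound_fun set"
    and r :: nat
    and D :: "('s, 'a) data_record multiset"
    and s\<^sub>t :: 's
    and a\<^sub>t :: 'a
    and \<delta>' :: real
  assumes "randomized_algorithm g \<Omega> P M"
    and "\<And>s a. (\<lambda>p. Q p s a) \<in> borel_measurable P"
    and "tie_rule tie"
    and "ADP_family \<K> \<or> RDP_family \<K>"
    and "outcomes_guarantee g \<Omega> P M \<K> r"
    and "D \<in> datasets g"
    and "a\<^sub>t = argmax tie (inferred_score \<Omega> Q tie (M D) s\<^sub>t)"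
    and "\<exists>K\<^sub>1\<in>\<K>. \<exists>K\<^sub>2\<in>\<K>.
           ereal (K_inv K\<^sub>1 (inferred_score \<Omega> Q tie (M D) s\<^sub>t a\<^sub>t)) >
           (SUP a\<in>UNIV - {a\<^sub>t}. ereal (K_fun K\<^sub>2 (inferred_score \<Omega> Q tie (M D) s\<^sub>t a)))"
    and "0 < \<delta>'" and "\<delta>' < 1"
  shows "action_level_robust g \<Omega> Q tie M D s\<^sub>t r \<delta>'"
proof -
  let ?I = "\<lambda>D a. inferred_score \<Omega> Q tie (M D) s\<^sub>t a"
  interpret prob_space \<Omega>
    using assms(1) by (simp add: randomized_algorithm_def)
  have guarantee: "?I D\<^sub>1 a \<le> K_fun K (?I D\<^sub>2 a)"
    if "K \<in> \<K>" "D\<^sub>1 \<in> datasets g" "D\<^sub>2 \<in> poison_ball g D\<^sub>1 r" for K D\<^sub>1 D\<^sub>2 a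
  proof -
    let ?S = "{p \<in> space P. argmax tie (Q p s\<^sub>t) = a}"
    \<comment> \<open>Measurability of \<open>M E\<close> keeps its values inside
      \<open>space P\<close>, so restricting \<open>?S\<close> to that space does not change the
      event.\<close>
    have score: "?I E a = \<P>(\<omega> in \<Omega>. M E \<omega> \<in> ?S)" if "E \<in> datasets g" for E
      using assms(1) that
      by (auto simp: randomized_algorithm_def inferred_score_def dest: measurable_space
          intro!: arg_cong[where f = prob])
    have "?S \<in> sets P"
      by (rule argmax_vimage_sets) (rule assms(2))
    moreover have "D\<^sub>2 \<in> datasets g"
      using that(3) by (simp add: poison_ball_def)
    ultimately show ?thesis
      unfolding score[OF that(2)] score[OF \<open>D\<^sub>2 \<in> datasets g\<close>]
      using assms(5) that unfolding outcomes_guarantee_def by blast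
  qed
  have score_nonneg: "0 \<le> ?I E a" for E a
    by (simp add: inferred_score_def)
  obtain K\<^sub>1 K\<^sub>2 where K: "K\<^sub>1 \<in> \<K>" "K\<^sub>2 \<in> \<K>"
    and gap: "(SUP a\<in>UNIV - {a\<^sub>t}. ereal (K_fun K\<^sub>2 (?I D a))) < ereal (K_inv K\<^sub>1 (?I D a\<^sub>t))"
    using assms(8) by blast
  have "policy_action \<Omega> Q tie (M D') s\<^sub>t = a\<^sub>t" if D': "D' \<in> poison_ball g D r" for D'
    unfolding policy_action_def
  proof (rule argmax_eqI[OF assms(3)])
    fix a
    assume "a \<noteq> a\<^sub>t"
    have "?I D' a \<le> K_fun K\<^sub>2 (?I D a)"
      using D' K(2) poison_ball_sym[OF assms(6) D'] by (auto intro!: guarantee simp: poison_ball_def)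
    also have "\<dots> < K_inv K\<^sub>1 (?I D a\<^sub>t)"
    proof -
      have "ereal (K_fun K\<^sub>2 (?I D a)) \<le> (SUP a\<in>UNIV - {a\<^sub>t}. ereal (K_fun K\<^sub>2 (?I D a)))"
        using \<open>a \<noteq> a\<^sub>t\<close> by (intro SUP_upper) simp
      then show ?thesis
        using gap by (metis order.strict_trans1 less_ereal.simps(1))
    qed
    also have "\<dots> \<le> ?I D' a\<^sub>t"
      by (rule K_inv_le_of_le_K_fun[OF assms(4) K(1)])
        (rule score_nonneg guarantee[OF K(1) assms(6) D'])+
    finally show "?I D' a < ?I D' a\<^sub>t" .
  qed
  moreover have "policy_action \<Omega> Q tie (M D) s\<^sub>t = a\<^sub>t"
    by (simp add: policy_action_def assms(7))
  \<comment> \<open>Both actions equal \<open>a\<^sub>t\<close> for every \<omega>, so the event is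
    the whole space and has probability 1, which exceeds 1 - \<delta>'.\<close>
  ultimately show ?thesis
    using assms(9) by (auto simp: action_level_robust_def prob_space)
qed

end
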